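(* Let $\Omega \subset \mathbb{R}^d$ be open and non-empty, and let $X$ be a set such that $\Omega \subset X \subset \overline{\Omega}$. Let $S = (S_t)_{t>0}$ be a semigroup in $L_2(\Omega)$ such that $S_t L_2(\Omega) \subset C(X)$ and $S_t^* L_2(\Omega) \subset C(X)$ for all $t > 0$. Suppose the semigroup satisfies Gaussian bounds, that is, there are $b, c, \omega > 0$ such that the separately continuous kernel $K_t \colon X \times X \to \mathbb{C}$ of $S_t$ satisfies $$|K_t(x,y)| \le c\, t^{-d/2}\, e^{-b |x-y|^2 t^{-1}}\, e^{\omega t}$$ for all $x,y \in \Omega$ and $t > 0$. Then $K_t$ is (jointly) continuous on $X \times X$ for all $t > 0$.
   Context: $L_2(\Omega)$ is the complex Hilbert space of (classes of) square-integrable functions on $\Omega$ with Lebesgue measure; $C(X)$ is the space of complex-valued continuous functions on $X$. A semigroup in $L_2(\Omega)$ is a family of bounded operators $S_t$ on $L_2(\Omega)$ with $S_{t+s} = S_t S_s$ for all $s,t>0$. For a bounded operator $T$ on $L_2(\Omega)$ the inclusion $T L_2(\Omega) \subset C(X)$ means that for every $u \in L_2(\Omega)$ the element $Tu$ has a representative on $\Omega$ which extends to a (necessarily unique) continuous function on $X$; $Tu$ is identified with this continuous function. The hypotheses $S_t L_2(\Omega) \subset C(X)$ and $S_t^* L_2(\Omega) \subset C(X)$ for all $t>0$ imply that for every $t>0$ there exists a unique separately continuous function $K_t \colon X \times X \to \mathbb{C}$ (i.e. continuous in each variable separately), which is measurable, such that $K_t(x,\cdot) \in L_2(\Omega)$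 for all $x \in X$ and $(S_t u)(x) = \int_\Omega K_t(x,y)\, u(y)\, dy$ for all $u \in L_2(\Omega)$ and $x \in X$; this $K_t$ is called the separately continuous kernel of $S_t$. *)

theory Defs
  imports "HOL-Analysis.Analysis"
begin

text \<open>
  Elements of \<open>L\<^sub>2(\<Omega>)\<close> are handled through representatives: \<open>L2 \<Omega>\<close> is the set of
  square-integrable functions, and equality of classes is \<open>L2_eq \<Omega>\<close>, equality almost everywhere
  on \<open>\<Omega>\<close>. Values of representatives outside \<open>\<Omega>\<close> are irrelevant.
\<close>

definition L2 :: "'a::euclidean_space set \<Rightarrow> ('a \<Rightarrow> complex) set" where
  "L2 \<Omega> = {u. u \<in> borel_measurable (lebesgue_on \<Omega>) \<and>
               integrable (lebesgue_on \<Omega>) (\<lambda>x. (norm (u x))\<^sup>2)}"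

definition L2_eq :: "'a::euclidean_space set \<Rightarrow> ('a \<Rightarrow> complex) \<Rightarrow> ('a \<Rightarrow> complex) \<Rightarrow> bool" where
  "L2_eq \<Omega> u v \<longleftrightarrow> (AE x in lebesgue_on \<Omega>. u x = v x)"

definition L2_inner :: "'a::euclidean_space set \<Rightarrow> ('a \<Rightarrow> complex) \<Rightarrow> ('a \<Rightarrow> complex) \<Rightarrow> complex" where
  "L2_inner \<Omega> u v = (LINT x|lebesgue_on \<Omega>. u x * cnj (v x))"

definition L2_norm :: "'a::euclidean_space set \<Rightarrow> ('a \<Rightarrow> complex) \<Rightarrow> real" where
  "L2_norm \<Omega> u = sqrt (LINT x|lebesgue_on \<Omega>. (norm (u x))\<^sup>2)"

text \<open>The second conjunct says that \<open>T\<close> is well defined on classes.\<close>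

definition L2_bounded_operator ::
  "'a::euclidean_space set \<Rightarrow> (('a \<Rightarrow> complex) \<Rightarrow> ('a \<Rightarrow> complex)) \<Rightarrow> bool" where
  "L2_bounded_operator \<Omega> T \<longleftrightarrow>
     (\<forall>u\<in>L2 \<Omega>. T u \<in> L2 \<Omega>) \<and>
     (\<forall>u\<in>L2 \<Omega>. \<forall>v\<in>L2 \<Omega>. L2_eq \<Omega> u v \<longrightarrow> L2_eq \<Omega> (T u) (T v)) \<and>
     (\<forall>u\<in>L2 \<Omega>. \<forall>v\<in>L2 \<Omega>. L2_eq \<Omega> (T (\<lambda>x. u x + v x)) (\<lambda>x. T u x + T v x)) \<and>
     (\<forall>a. \<forall>u\<in>L2 \<Omega>. L2_eq \<Omega> (T (\<lambda>x. a * u x)) (\<lambda>x. a * T u x)) \<and>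
     (\<exists>C. \<forall>u\<in>L2 \<Omega>. L2_norm \<Omega> (T u) \<le> C * L2_norm \<Omega> u)"

text \<open>The Hilbert space adjoint; for bounded \<open>T\<close> it is unique up to \<open>L2_eq \<Omega>\<close> on \<open>L2 \<Omega>\<close>.\<close>

definition L2_adjoint ::
  "'a::euclidean_space set \<Rightarrow> (('a \<Rightarrow> complex) \<Rightarrow> ('a \<Rightarrow> complex)) \<Rightarrow> ('a \<Rightarrow> complex) \<Rightarrow> ('a \<Rightarrow> complex)"
  where
  "L2_adjoint \<Omega> T = (SOME T'. L2_bounded_operator \<Omega> T' \<and>
     (\<forall>u\<in>L2 \<Omega>. \<forall>v\<in>L2 \<Omega>. L2_inner \<Omega> (T u) v = L2_inner \<Omega> u (T' v)))"

text \<open>No continuity in \<open>t\<close> is required.\<close>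

definition L2_semigroup ::
  "'a::euclidean_space set \<Rightarrow> (real \<Rightarrow> ('a \<Rightarrow> complex) \<Rightarrow> ('a \<Rightarrow> complex)) \<Rightarrow> bool" where
  "L2_semigroup \<Omega> S \<longleftrightarrow>
     (\<forall>t>0. L2_bounded_operator \<Omega> (S t)) \<and>
     (\<forall>t>0. \<forall>s>0. \<forall>u\<in>L2 \<Omega>. L2_eq \<Omega> (S (t + s) u) (S t (S s u)))"

definition is_continuous_version ::
  "'a::euclidean_space set \<Rightarrow> 'a set \<Rightarrow> ('a \<Rightarrow> complex) \<Rightarrow> ('a \<Rightarrow> complex) \<Rightarrow> bool" where
  "is_continuous_version \<Omega> X f g \<longleftrightarrow> continuous_on X g \<and> L2_eq \<Omega> f g"

text \<open>
  The continuous function on \<open>X\<close> with which \<open>f\<close> is identified. If \<open>\<Omega>\<close> is open and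
  \<open>\<Omega> \<subseteq> X \<subseteq> closure \<Omega>\<close>, its values on \<open>X\<close> do not depend on the choice.
\<close>

definition continuous_version ::
  "'a::euclidean_space set \<Rightarrow> 'a set \<Rightarrow> ('a \<Rightarrow> complex) \<Rightarrow> ('a \<Rightarrow> complex)" where
  "continuous_version \<Omega> X f = (SOME g. is_continuous_version \<Omega> X f g)"

text \<open>The inclusion \<open>T L\<^sub>2(\<Omega>) \<subseteq> C(X)\<close>.\<close>

definition L2_range_in_C ::
  "'a::euclidean_space set \<Rightarrow> 'a set \<Rightarrow> (('a \<Rightarrow> complex) \<Rightarrow> ('a \<Rightarrow> complex)) \<Rightarrow> bool" where
  "L2_range_in_C \<Omega> X T \<longleftrightarrow> (\<forall>u\<in>L2 \<Omega>. \<exists>g. is_continuous_version \<Omega> X (T u) g)"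

definition separately_continuous_on ::
  "'a::topological_space set \<Rightarrow> 'b::topological_space set \<Rightarrow> ('a \<Rightarrow> 'b \<Rightarrow> 'c::topological_space) \<Rightarrow> bool"
  where
  "separately_continuous_on X Y k \<longleftrightarrow>
     (\<forall>x\<in>X. continuous_on Y (\<lambda>y. k x y)) \<and> (\<forall>y\<in>Y. continuous_on X (\<lambda>x. k x y))"

text \<open>
  \<open>k\<close> is the separately continuous kernel of \<open>T\<close>; only its values on \<open>X \<times> X\<close> matter, and they are
  uniquely determined by \<open>T\<close>. Since \<open>X\<close> need not be measurable, measurability refers to the Borel
  sets of the subspace \<open>X \<times> X\<close>.
\<close>

definition is_separately_continuous_kernel ::
  "'a::euclidean_space set \<Rightarrow> 'a set \<Rightarrow> (('a \<Rightarrow> complex) \<Rightarrow> ('a \<Rightarrow> complex)) \<Rightarrow> ('a \<Rightarrow> 'a \<Rightarrow> complex) \<Rightarrow> bool"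
  where
  "is_separately_continuous_kernel \<Omega> X T k \<longleftrightarrow>
     separately_continuous_on X X k \<and>
     (\<lambda>(x, y). k x y) \<in> borel_measurable (restrict_space borel (X \<times> X)) \<and>
     (\<forall>x\<in>X. k x \<in> L2 \<Omega>) \<and>
     (\<forall>u\<in>L2 \<Omega>. \<forall>x\<in>X. continuous_version \<Omega> X (T u) x = (LINT y|lebesgue_on \<Omega>. k x y * u y))"

end

theory Submission
  imports Defs "HOL-Probability.Distributions"
begin

text \<open>
  By the semigroup law and Fubini's theorem, \<open>K\<^sub>t(x,y) = \<integral>\<^sub>\<Omega> K\<^sub>t\<^sub>/\<^sub>2(x,z) K\<^sub>t\<^sub>/\<^sub>2(z,y) dz\<close> for every
  \<open>x \<in> X\<close> and almost every \<open>y \<in> \<Omega>\<close>. The Gaussian bound extends from \<open>\<Omega>\<close> to \<open>X\<close> by separate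
  continuity, and a Gaussian centred at \<open>x'\<close> is, for \<open>x'\<close> near \<open>x\<close>, below a fixed multiple of a wider
  Gaussian centred at \<open>x\<close>. So dominated convergence turns separate continuity of the integrand into
  joint continuity of the integral; in particular the identity holds for all \<open>x, y \<in> X\<close>.
\<close>

section \<open>Integrability facts for Lebesgue measure on a subset\<close>

text \<open>Required for Fubini over the product of two copies of
  \<open>lebesgue_on \<Omega>\<close>. Completion does not change the measure of a Borel set, so a
  countable Borel cover of finite-measure pieces for \<open>lborel\<close> also serves
  \<open>lebesgue\<close>.\<close>

lemma sigma_finite_lebesgue_on:
  fixes A :: "'a::euclidean_space set"
  assumes "A \<in> sets lebesgue"
  shows "sigma_finite_measure (lebesgue_on A)"
proof (rule sigma_finite_measure_restrict_space[OF _ assms])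
  obtain C :: "'a set set" where C: "countable C" "C \<subseteq> sets lborel" "\<Union>C = space lborel"
    "\<forall>a\<in>C. emeasure lborel a \<noteq> \<infinity>"
    using lborel.sigma_finite_countable by blast
  then have "C \<subseteq> sets lebesgue" "\<forall>a\<in>C. emeasure lebesgue a \<noteq> \<infinity>"
    by (auto simp: subset_iff)
  with C show "sigma_finite_measure (lebesgue :: 'a measure)"
    by (intro sigma_finite_measure.intro exI[of _ C]) auto
qed

lemma integrable_lborel_gaussian_real:
  assumes "a > (0::real)"
  shows "integrable lborel (\<lambda>x::real. exp (- a * (x - m)\<^sup>2))"
proof -
  \<comment> \<open>The standard deviation for which the normal density has exponent
    \<open>- a * (x - m)\<^sup>2\<close>; the factor in front below cancels its
    normalisation.\<close>
  define s where "s = sqrt (1 / (2 * a))"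
  have s: "2 * s\<^sup>2 = 1 / a" "s > 0" using assms by (simp_all add: s_def)
  have "integrable lborel (\<lambda>x. sqrt (2 * pi * s\<^sup>2) * normal_density m s x)"
    using s(2) by simp
  moreover have "sqrt (2 * pi * s\<^sup>2) * normal_density m s x = exp (- a * (x - m)\<^sup>2)" for x
    using assms s unfolding normal_density_def by (auto simp: s_def)
  ultimately show ?thesis by simp
qed

text \<open>By Pythagoras the Gaussian is a product of one-dimensional Gaussians in the coordinates,
  and the integral of such a product factorises.\<close>

lemma integrable_lborel_gaussian:
  fixes m :: "'a::euclidean_space"
  assumes "a > 0"
  shows "integrable lborel (\<lambda>x. exp (- a * (norm (x - m))\<^sup>2))"
proof (rule integrableI_bounded)
  have prod: "exp (- a * (norm (x - m))\<^sup>2) = (\<Prod>b\<in>Basis. exp (- a * (x \<bullet> b - m \<bullet> b)\<^sup>2))" for x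
  proof -
    have "(norm (x - m))\<^sup>2 = (\<Sum>b\<in>Basis. (x \<bullet> b - m \<bullet> b)\<^sup>2)"
      unfolding power2_norm_eq_inner euclidean_inner[of "x - m" "x - m"]
      by (simp add: inner_diff_left power2_eq_square)
    then show ?thesis
      by (simp only: sum_distrib_left exp_sum[OF finite_Basis])
  qed
  have fin: "(\<integral>\<^sup>+x. ennreal (exp (- a * (x - c)\<^sup>2)) \<partial>lborel) < \<infinity>" for c :: real
    using integrable_lborel_gaussian_real[OF assms, of c]
    by (simp add: integrable_iff_bounded)
  have "(\<integral>\<^sup>+x. ennreal (norm (exp (- a * (norm (x - m))\<^sup>2))) \<partial>lborel)
      = (\<integral>\<^sup>+x. (\<Prod>b\<in>Basis. ennreal (exp (- a * (x \<bullet> b - m \<bullet> b)\<^sup>2))) \<partial>lborel)"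
    by (subst prod_ennreal) (simp_all only: prod real_norm_def abs_exp_cancel abs_prod exp_ge_zero)
  also have "\<dots> = (\<Prod>b\<in>Basis. \<integral>\<^sup>+x. ennreal (exp (- a * (x - m \<bullet> b)\<^sup>2)) \<partial>lborel)"
    by (rule nn_integral_lborel_prod) auto
  also have "\<dots> < \<infinity>"
    using fin by (simp add: ennreal_prod_eq_top less_top[symmetric] less_imp_neq del: mult_minus_left)
  finally show "(\<integral>\<^sup>+x. ennreal (norm (exp (- a * (norm (x - m))\<^sup>2))) \<partial>lborel) < \<infinity>" .
qed simp

lemma integrable_lebesgue_on_gaussian:
  fixes m :: "'a::euclidean_space"
  assumes "a > 0" "A \<in> sets lebesgue"
  shows "integrable (lebesgue_on A) (\<lambda>x. exp (- a * (norm (x - m))\<^sup>2))"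
proof -
  have "integrable lebesgue (\<lambda>x. exp (- a * (norm (x - m))\<^sup>2))"
    using integrable_lborel_gaussian[OF assms(1)] by (subst integrable_completion) simp_all
  then show ?thesis
    using integrable_mult_indicator[OF assms(2)] assms(2)
    by (subst integrable_restrict_space) (auto simp del: mult_minus_left real_scaleR_def)
qed

text \<open>Supplies majorants for bounded functions supported in a ball, also when \<Omega> has
  infinite measure.\<close>

lemma integrable_lebesgue_on_cball:
  fixes m :: "'a::euclidean_space"
  assumes "A \<in> sets lebesgue"
  shows "integrable (lebesgue_on A) (indicator (cball m r) :: 'a \<Rightarrow> real)"
proof -
  have "integrable lebesgue (indicator (cball m r) :: 'a \<Rightarrow> real)"
    using emeasure_lborel_cball_finite[of m r] by (intro integrable_real_indicator) auto
  from integrable_mult_indicator[OF assms this] show ?thesis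
    using assms by (simp add: integrable_restrict_space)
qed

section \<open>Gaussian bounds and continuity of the composed kernel\<close>

text \<open>Gives a majorant that no longer depends on the moving centre \<open>x\<close>. From
  |z-y|^2 \<le> 2|x-z|^2 + 2|x-y|^2 and |x-y| \<le> 1, multiplication by a/2 yields (a/2)|z-y|^2
  \<le> a|x-z|^2 + a; halving the rate absorbs the cross term.\<close>

lemma gaussian_le_shifted:
  fixes x y z :: "'a::real_normed_vector"
  assumes "a > 0" "norm (x - y) \<le> 1"
  shows "exp (- a * (norm (x - z))\<^sup>2) \<le> exp a * exp (- (a / 2) * (norm (z - y))\<^sup>2)"
proof -
  have "norm (z - y) \<le> norm (x - z) + norm (x - y)"
    using norm_triangle_ineq4[of "x - y" "x - z"] by simp
  then have "(norm (z - y))\<^sup>2 \<le> (norm (x - z) + norm (x - y))\<^sup>2"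
    by (simp add: power_mono)
  also have "\<dots> \<le> 2 * (norm (x - z))\<^sup>2 + 2 * (norm (x - y))\<^sup>2"
    using sum_squares_bound[of "norm (x - z)" "norm (x - y)"] by (simp add: power2_sum)
  also have "\<dots> \<le> 2 * (norm (x - z))\<^sup>2 + 2"
    using power_mono[OF assms(2), of 2] by simp
  finally have "a * (norm (z - y))\<^sup>2 \<le> a * (2 * (norm (x - z))\<^sup>2 + 2)"
    using assms(1) by simp
  then show ?thesis
    by (simp add: exp_add[symmetric] algebra_simps)
qed

text \<open>Take limits along a sequence in \<Omega> converging to \<open>x\<close>. With the norm
  of a difference as \<open>f\<close> and zero as \<open>g\<close>, this also extends
  equalities.\<close>

lemma continuous_on_le_dense:
  fixes f g :: "'a::metric_space \<Rightarrow> real"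
  assumes "continuous_on X f" "continuous_on X g" "\<Omega> \<subseteq> X" "X \<subseteq> closure \<Omega>"
    and "\<And>y. y \<in> \<Omega> \<Longrightarrow> f y \<le> g y" and "x \<in> X"
  shows "f x \<le> g x"
proof -
  obtain s where s: "\<And>n. s n \<in> \<Omega>" "s \<longlonglongrightarrow> x"
    using assms(4,6) closure_sequential[of x \<Omega>] by blast
  have "(\<lambda>n. f (s n)) \<longlonglongrightarrow> f x" "(\<lambda>n. g (s n)) \<longlonglongrightarrow> g x"
    using assms(1-3,6) s
    by (auto intro!: continuous_on_tendsto_compose[of X] always_eventually)
  then show ?thesis
    by (rule LIMSEQ_le) (use assms(5) s in auto)
qed

text \<open>The bound is extended one variable at a time: first in \<open>y\<close> with
  \<open>x\<close> still in \<Omega>, then in \<open>x\<close> for arbitrary \<open>y\<close> in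
  \<open>X\<close>. Each passage uses continuity in a single variable.\<close>

lemma separately_continuous_gaussian_extends:
  fixes k :: "'a::real_normed_vector \<Rightarrow> 'a \<Rightarrow> complex"
  assumes "separately_continuous_on X X k" "\<Omega> \<subseteq> X" "X \<subseteq> closure \<Omega>"
    and "\<And>x y. x \<in> \<Omega> \<Longrightarrow> y \<in> \<Omega> \<Longrightarrow> norm (k x y) \<le> C * exp (- a * (norm (x - y))\<^sup>2)"
    and "x \<in> X" "y \<in> X"
  shows "norm (k x y) \<le> C * exp (- a * (norm (x - y))\<^sup>2)"
proof -
  have c: "continuous_on X (\<lambda>y. norm (k x y))" "continuous_on X (\<lambda>x. norm (k x y))"
    if "x \<in> X" "y \<in> X" for x y
    using assms(1) that by (auto simp: separately_continuous_on_def intro!: continuous_on_norm)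
  have gauss: "continuous_on X (\<lambda>y. C * exp (- a * (norm (x - y))\<^sup>2))"
    "continuous_on X (\<lambda>x. C * exp (- a * (norm (x - y))\<^sup>2))" for x y
    by (intro continuous_intros)+
  have bound': "norm (k x y) \<le> C * exp (- a * (norm (x - y))\<^sup>2)" if "x \<in> \<Omega>" for x
    by (rule continuous_on_le_dense[OF c(1) gauss(1) assms(2,3) assms(4) assms(6)])
      (use assms(2,6) that in auto)
  show ?thesis
    by (rule continuous_on_le_dense[OF c(2) gauss(2) assms(2,3) bound' assms(5)])
      (use assms in auto)
qed

text \<open>For fixed \<open>z\<close> the first factor depends only on the left variable and the
  second only on the right one, so separate continuity already makes the integrand converge along
  any convergent sequence of pairs. Dominated convergence does the rest.\<close>

lemma continuous_on_gaussian_composition: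
  fixes k :: "'a::euclidean_space \<Rightarrow> 'a \<Rightarrow> complex"
  assumes \<Omega>: "\<Omega> \<in> sets lebesgue" "\<Omega> \<subseteq> X"
    and sep: "separately_continuous_on X X k"
    and "a > 0" "C \<ge> 0"
    and bound: "\<And>x y. x \<in> X \<Longrightarrow> y \<in> X \<Longrightarrow> norm (k x y) \<le> C * exp (- a * (norm (x - y))\<^sup>2)"
  shows "continuous_on (X \<times> X) (\<lambda>(x, y). LINT z|lebesgue_on \<Omega>. k x z * k z y)"
  unfolding continuous_on_sequentially
proof (intro allI ballI impI, elim conjE)
  fix s :: "nat \<Rightarrow> 'a \<times> 'a" and p
  assume p: "p \<in> X \<times> X" and sX: "\<forall>n. s n \<in> X \<times> X" and lim: "s \<longlonglongrightarrow> p"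
  obtain x y where xy: "p = (x, y)" "x \<in> X" "y \<in> X"
    using p by auto
  have limx: "(\<lambda>n. fst (s n)) \<longlonglongrightarrow> x" and limy: "(\<lambda>n. snd (s n)) \<longlonglongrightarrow> y"
    using tendsto_fst[OF lim] tendsto_snd[OF lim] by (simp_all add: xy)
  have sX': "fst (s n) \<in> X" "snd (s n) \<in> X" for n
    using sX by (auto simp: mem_Times_iff)
  have "\<forall>\<^sub>F n in sequentially. dist (fst (s n)) x < 1"
    using limx by (rule tendstoD) simp
  \<comment> \<open>Dropping the first \<open>N\<close> terms keeps all centres within distance 1 of
    \<open>x\<close>, as \<open>gaussian_le_shifted\<close> demands.\<close>
  then obtain N where N: "\<And>n. n \<ge> N \<Longrightarrow> norm (fst (s n) - x) \<le> 1"
    unfolding eventually_sequentially dist_norm by (meson less_imp_le)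
  have meas: "(\<lambda>z. k u z * k z v) \<in> borel_measurable (lebesgue_on \<Omega>)" if "u \<in> X" "v \<in> X" for u v
    by (rule continuous_imp_measurable_on_sets_lebesgue)
      (use sep \<Omega> that in \<open>auto simp: separately_continuous_on_def
          intro!: continuous_intros intro: continuous_on_subset\<close>)
  have conv: "(\<lambda>n. LINT z|lebesgue_on \<Omega>. k (fst (s (n + N))) z * k z (snd (s (n + N))))
      \<longlonglongrightarrow> (LINT z|lebesgue_on \<Omega>. k x z * k z y)"
  proof (rule integral_dominated_convergence)
    show "integrable (lebesgue_on \<Omega>) (\<lambda>z. C * exp a * C * exp (- (a / 2) * (norm (z - x))\<^sup>2))"
      using integrable_lebesgue_on_gaussian[of "a / 2" \<Omega> x] \<open>a > 0\<close> \<Omega>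
      by (intro integrable_mult_right) auto
    show "AE z in lebesgue_on \<Omega>. (\<lambda>n. k (fst (s (n + N))) z * k z (snd (s (n + N))))
        \<longlonglongrightarrow> k x z * k z y"
    proof (rule AE_I2)
      fix z assume "z \<in> space (lebesgue_on \<Omega>)"
      then have "z \<in> X" using \<Omega> by auto
      then have "(\<lambda>n. k (fst (s n)) z) \<longlonglongrightarrow> k x z" "(\<lambda>n. k z (snd (s n))) \<longlonglongrightarrow> k z y"
        using sep xy sX' unfolding separately_continuous_on_def
        by (auto intro: continuous_on_tendsto_compose[OF _ limx] continuous_on_tendsto_compose[OF _ limy])
      then show "(\<lambda>n. k (fst (s (n + N))) z * k z (snd (s (n + N)))) \<longlonglongrightarrow> k x z * k z y"
        by (intro LIMSEQ_ignore_initial_segment[of "\<lambda>n. k (fst (s n)) z * k z (snd (s n))"]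
            tendsto_mult)
    qed
    fix n
    show "AE z in lebesgue_on \<Omega>. norm (k (fst (s (n + N))) z * k z (snd (s (n + N))))
        \<le> C * exp a * C * exp (- (a / 2) * (norm (z - x))\<^sup>2)"
    proof (rule AE_I2)
      fix z assume "z \<in> space (lebesgue_on \<Omega>)"
      then have "z \<in> X" using \<Omega> by auto
      have "norm (k (fst (s (n + N))) z) \<le> C * (exp a * exp (- (a / 2) * (norm (z - x))\<^sup>2))"
        using bound[OF sX'(1) \<open>z \<in> X\<close>] gaussian_le_shifted[OF \<open>a > 0\<close> N, of "n + N" z] \<open>C \<ge> 0\<close>
        by (meson le_add2 mult_left_mono order_trans)
      \<comment> \<open>The decay of the first factor makes the majorant integrable, so for the
        second one the supremum bound suffices.\<close>
      moreover have "norm (k z (snd (s (n + N)))) \<le> C"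
        by (rule order_trans[OF bound[OF \<open>z \<in> X\<close> sX'(2)]])
          (use \<open>a > 0\<close> \<open>C \<ge> 0\<close> in \<open>simp add: mult_left_le\<close>)
      ultimately have "norm (k (fst (s (n + N))) z * k z (snd (s (n + N))))
          \<le> C * (exp a * exp (- (a / 2) * (norm (z - x))\<^sup>2)) * C"
        unfolding norm_mult by (intro mult_mono) (use \<open>C \<ge> 0\<close> in auto)
      then show "norm (k (fst (s (n + N))) z * k z (snd (s (n + N))))
          \<le> C * exp a * C * exp (- (a / 2) * (norm (z - x))\<^sup>2)"
        by (simp only: mult_ac)
    qed
  qed (use meas xy sX' in auto)
  show "((\<lambda>(x, y). LINT z|lebesgue_on \<Omega>. k x z * k z y) \<circ> s)
      \<longlonglongrightarrow> (case p of (x, y) \<Rightarrow> LINT z|lebesgue_on \<Omega>. k x z * k z y)"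
    by (rule LIMSEQ_offset[where k = N]) (use conv in \<open>simp add: xy comp_def case_prod_beta\<close>)
qed

section \<open>Identifying continuous functions by test integrals\<close>

text \<open>Testing with the conjugate of \<open>f - g\<close>, cut off to a closed ball around
  \<open>x\<close> inside \<Omega>, makes the integral of |f-g|^2 over that ball vanish. Hence f = g
  almost everywhere there, and at \<open>x\<close> by continuity.\<close>

lemma continuous_eq_if_test_integrals_eq:
  fixes f g :: "'a::euclidean_space \<Rightarrow> complex"
  assumes \<Omega>: "open \<Omega>" and cont: "continuous_on \<Omega> f" "continuous_on \<Omega> g"
    and test: "\<And>u B R. u \<in> borel_measurable (lebesgue_on \<Omega>) \<Longrightarrow>
        (\<And>x. norm (u x) \<le> B * indicator (cball 0 R) x) \<Longrightarrow>
        (LINT x|lebesgue_on \<Omega>. f x * u x) = (LINT x|lebesgue_on \<Omega>. g x * u x)"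
    and "x \<in> \<Omega>"
  shows "f x = g x"
proof -
  obtain r where r: "r > 0" "cball x r \<subseteq> \<Omega>"
    using \<Omega> \<open>x \<in> \<Omega>\<close> open_contains_cball by blast
  define h where "h = (\<lambda>y. f y - g y)"
  define I where "I = (indicator (cball x r) :: 'a \<Rightarrow> complex)"
  define u where "u = (\<lambda>y. cnj (h y) * I y)"
  have ch: "continuous_on \<Omega> h"
    unfolding h_def by (intro continuous_intros cont)
  have bdd: "\<exists>B. \<forall>y\<in>cball x r. norm (q y) \<le> B" if "continuous_on \<Omega> q" for q :: "'a \<Rightarrow> complex"
    using compact_imp_bounded[OF compact_continuous_image[OF continuous_on_subset[OF that r(2)]
      compact_cball]] by (auto simp: bounded_iff)
  obtain B where B: "\<And>y. y \<in> cball x r \<Longrightarrow> norm (h y) \<le> B"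
    using bdd[OF ch] by blast
  have leb: "\<Omega> \<in> sets lebesgue" using \<Omega> by auto
  have meas: "q \<in> borel_measurable (lebesgue_on \<Omega>)" if "continuous_on \<Omega> q" for q :: "'a \<Rightarrow> complex"
    using that leb by (rule continuous_imp_measurable_on_sets_lebesgue)
  have "I \<in> borel_measurable lebesgue"
    unfolding I_def by (intro borel_measurable_indicator) auto
  then have mI: "I \<in> borel_measurable (lebesgue_on \<Omega>)"
    by (rule measurable_restrict_space1)
  have mu: "u \<in> borel_measurable (lebesgue_on \<Omega>)"
    unfolding u_def by (intro borel_measurable_times mI meas continuous_on_cnj ch)
  \<comment> \<open>The ball around \<open>x\<close> of radius \<open>r\<close> lies in the ball
    around 0 of radius \<open>norm x + r\<close>, which is the form of support that
    \<open>test\<close> accepts.\<close>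
  have ub: "norm (u y) \<le> B * indicator (cball 0 (norm x + r)) y" for y
  proof (cases "y \<in> cball x r")
    case True
    then have "norm y \<le> norm x + r"
      using norm_triangle_ineq[of x "y - x"] by (simp add: dist_norm norm_minus_commute)
    with True B[of y] show ?thesis by (simp add: u_def I_def norm_mult)
  next
    case False
    have "B \<ge> 0" using order_trans[OF norm_ge_zero B[of x]] r(1) by simp
    with False show ?thesis by (simp add: u_def I_def)
  qed
  \<comment> \<open>Splitting the integral of \<open>h y * u y\<close> into a difference requires
    both parts to be integrable. \<open>f\<close> and \<open>g\<close> may be unbounded on \<Omega>,
    but they are bounded on the compact support of \<open>u\<close>.\<close>
  have int: "integrable (lebesgue_on \<Omega>) (\<lambda>y. q y * u y)" if q: "continuous_on \<Omega> q" for q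
  proof -
    obtain D where D: "\<And>y. y \<in> cball x r \<Longrightarrow> norm (q y) \<le> D"
      using bdd[OF q] by blast
    have "integrable (lebesgue_on \<Omega>) (\<lambda>y. D * B * indicator (cball x r) y)"
      using integrable_lebesgue_on_cball[OF leb] by simp
    then show ?thesis
    proof (rule Bochner_Integration.integrable_bound)
      show "AE y in lebesgue_on \<Omega>. norm (q y * u y) \<le> norm (D * B * indicator (cball x r) y :: real)"
      proof (rule AE_I2)
        fix y
        show "norm (q y * u y) \<le> norm (D * B * indicator (cball x r) y :: real)"
        proof (cases "y \<in> cball x r")
          case True
          have "norm (q y) * norm (h y) \<le> D * B"
            using True D[of y] B[of y] order_trans[OF norm_ge_zero D[of y]] by (intro mult_mono) auto
          with True show ?thesis by (simp add: u_def I_def norm_mult)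
        qed (simp add: u_def I_def)
      qed
    qed (intro borel_measurable_times mu meas q)
  qed
  \<comment> \<open>The integrand in real form, so that a nonnegative function with zero integral
    can be concluded to vanish almost everywhere.\<close>
  define w where "w = (\<lambda>y. (norm (h y))\<^sup>2 * indicator (cball x r) y)"
  have w: "h y * u y = complex_of_real (w y)" for y
    by (auto simp: w_def u_def I_def complex_norm_square[symmetric] indicator_def)
  have "integrable (lebesgue_on \<Omega>) (\<lambda>y. complex_of_real (w y))"
    using int[OF ch] by (simp add: w)
  then have iw: "integrable (lebesgue_on \<Omega>) w"
    by (simp add: complex_of_real_integrable_eq)
  have "(LINT y|lebesgue_on \<Omega>. h y * u y) = 0"
    using test[OF mu ub] int[OF cont(1)] int[OF cont(2)]
    by (simp add: h_def left_diff_distrib)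
  then have "(LINT y|lebesgue_on \<Omega>. w y) = 0"
    by (simp add: w)
  then have "AE y in lebesgue_on \<Omega>. w y = 0"
    by (subst (asm) integral_nonneg_eq_0_iff_AE[OF iw]) (auto simp: w_def)
  then have ae: "AE y in lebesgue. y \<in> \<Omega> \<longrightarrow> w y = 0"
    using leb by (simp add: AE_restrict_space_iff)
  \<comment> \<open>An open set that is Lebesgue-null is empty. This is expressed below as: almost
    every point of \<open>U\<close> lies in the closed set \<open>{}\<close>, hence every point
    does.\<close>
  define U where "U = {y \<in> ball x r. h y \<noteq> 0}"
  have "continuous_on (ball x r) h"
    by (rule continuous_on_subset[OF ch]) (use r ball_subset_cball in blast)
  then have "open U"
    using continuous_on_open_vimage[of "ball x r" h] open_Compl[OF closed_singleton[of "0::complex"]]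
    by (auto simp: U_def vimage_def Int_def conj_commute)
  moreover have "AE y \<in> U in lebesgue. y \<in> {}"
    using ae by eventually_elim (use r(2) ball_subset_cball in \<open>auto simp: U_def w_def less_imp_le subset_iff\<close>)
  ultimately have "x \<notin> U"
    using mem_closed_if_AE_lebesgue_open[of U "{}" x] by auto
  then show ?thesis
    using r by (simp add: U_def h_def)
qed

section \<open>Continuous versions and admissible test functions\<close>

text \<open>Almost everywhere equal functions have the same continuous versions, so
  \<open>SOME\<close> is applied to one and the same predicate and selects the same
  function.\<close>

lemma continuous_version_cong:
  assumes "L2_eq \<Omega> f f'"
  shows "continuous_version \<Omega> X f = continuous_version \<Omega> X f'"
proof -
  have "is_continuous_version \<Omega> X f = is_continuous_version \<Omega> X f'"
    using assms unfolding is_continuous_version_def L2_eq_def fun_eq_iff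
    by (auto elim: eventually_elim2)
  then show ?thesis by (simp add: continuous_version_def)
qed

lemma is_continuous_version_continuous_version:
  assumes "L2_range_in_C \<Omega> X T" "u \<in> L2 \<Omega>"
  shows "is_continuous_version \<Omega> X (T u) (continuous_version \<Omega> X (T u))"
  unfolding continuous_version_def using assms
  by (intro someI_ex[of "is_continuous_version \<Omega> X (T u)"]) (simp add: L2_range_in_C_def)

text \<open>Test functions must lie in \<open>L2 \<Omega>\<close> for the operators to act on them,
  and be integrable for the majorant in Fubini's theorem.\<close>

lemma integrable_bounded_support:
  fixes u :: "'a::euclidean_space \<Rightarrow> complex"
  assumes "\<Omega> \<in> sets lebesgue" "u \<in> borel_measurable (lebesgue_on \<Omega>)"
    and "\<And>x. norm (u x) \<le> B * indicator (cball 0 R) x"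
  shows "integrable (lebesgue_on \<Omega>) u" "u \<in> L2 \<Omega>"
proof -
  note ind = integrable_lebesgue_on_cball[OF assms(1), of 0 R]
  have "integrable (lebesgue_on \<Omega>) (\<lambda>x. B * indicator (cball 0 R) x)"
    using ind by simp
  then show "integrable (lebesgue_on \<Omega>) u"
    by (rule Bochner_Integration.integrable_bound)
      (use assms in \<open>auto intro: order_trans[OF _ abs_ge_self]\<close>)
  have "integrable (lebesgue_on \<Omega>) (\<lambda>x. B\<^sup>2 * indicator (cball 0 R) x)"
    using ind by simp
  then have "integrable (lebesgue_on \<Omega>) (\<lambda>x. (norm (u x))\<^sup>2)"
  proof (rule Bochner_Integration.integrable_bound)
    show "AE x in lebesgue_on \<Omega>. norm ((norm (u x))\<^sup>2) \<le> norm (B\<^sup>2 * indicator (cball 0 R) x :: real)"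
    proof (rule AE_I2)
      fix x
      show "norm ((norm (u x))\<^sup>2) \<le> norm (B\<^sup>2 * indicator (cball 0 R) x :: real)"
        using power_mono[OF assms(3)[of x], of 2] by (auto simp: indicator_def split: if_splits)
    qed
  qed (use assms(2) in measurable)
  then show "u \<in> L2 \<Omega>"
    using assms(2) by (simp add: L2_def)
qed

section \<open>The kernel of a composed operator\<close>

text \<open>Later \<open>T\<close> is the semigroup at half the time and \<open>R\<close> at the
  full time. For fixed \<open>x\<close>, both sides are continuous in \<open>y\<close>; they have
  equal integrals against test functions on \<Omega>, so they agree on \<Omega>, and by density on
  \<open>X\<close>.\<close>

lemma kernel_composition_eq:
  fixes k r :: "'a::euclidean_space \<Rightarrow> 'a \<Rightarrow> complex"
  assumes \<Omega>: "open \<Omega>" "\<Omega> \<subseteq> X" "X \<subseteq> closure \<Omega>"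
    and T: "\<And>u. u \<in> L2 \<Omega> \<Longrightarrow> T u \<in> L2 \<Omega>" "L2_range_in_C \<Omega> X T"
    and RTT: "\<And>u. u \<in> L2 \<Omega> \<Longrightarrow> L2_eq \<Omega> (R u) (T (T u))"
    and k: "is_separately_continuous_kernel \<Omega> X T k"
    and r: "is_separately_continuous_kernel \<Omega> X R r"
    and a: "a > 0" "C \<ge> 0"
    and bound: "\<And>x y. x \<in> X \<Longrightarrow> y \<in> X \<Longrightarrow> norm (k x y) \<le> C * exp (- a * (norm (x - y))\<^sup>2)"
    and xy: "x \<in> X" "y \<in> X"
  shows "r x y = (LINT z|lebesgue_on \<Omega>. k x z * k z y)"
proof -
  define M where "M = lebesgue_on \<Omega>"
  have leb: "\<Omega> \<in> sets lebesgue" using \<Omega> by auto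
  have spM: "space M = \<Omega>" using leb by (simp add: M_def)
  interpret M: sigma_finite_measure M
    unfolding M_def by (rule sigma_finite_lebesgue_on[OF leb])
  interpret P: pair_sigma_finite M M ..
  have sep: "separately_continuous_on X X k"
    and mk: "(\<lambda>(x, y). k x y) \<in> borel_measurable (restrict_space borel (X \<times> X))"
    and kL2: "k x \<in> L2 \<Omega>"
    and kT: "\<And>u x. u \<in> L2 \<Omega> \<Longrightarrow> x \<in> X \<Longrightarrow>
          continuous_version \<Omega> X (T u) x = (LINT y|M. k x y * u y)"
    using k xy by (auto simp: is_separately_continuous_kernel_def M_def)
  have rsep: "separately_continuous_on X X r"
    and rR: "\<And>u x. u \<in> L2 \<Omega> \<Longrightarrow> x \<in> X \<Longrightarrow>
          continuous_version \<Omega> X (R u) x = (LINT y|M. r x y * u y)"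
    using r by (auto simp: is_separately_continuous_kernel_def M_def)
  have idM: "(\<lambda>x. x) \<in> M \<rightarrow>\<^sub>M borel"
    using id_borel_measurable_lebesgue_on[of \<Omega>] by (simp add: M_def id_def)
  \<comment> \<open>The inclusion of \<Omega> \<times> \<Omega> into X \<times> X. It transfers the
    Borel measurability of \<open>k\<close> on the subspace, where \<open>X\<close> may be
    non-measurable, to the product measure.\<close>
  have "(\<lambda>p. (fst p, snd p)) \<in> (M \<Otimes>\<^sub>M M) \<rightarrow>\<^sub>M restrict_space borel (X \<times> X)"
  proof (rule measurable_restrict_space2)
    show "(\<lambda>p. (fst p, snd p)) \<in> space (M \<Otimes>\<^sub>M M) \<rightarrow> X \<times> X"
      using \<Omega> by (auto simp: space_pair_measure spM)
    show "(\<lambda>p. (fst p, snd p)) \<in> (M \<Otimes>\<^sub>M M) \<rightarrow>\<^sub>M borel"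
      by (intro borel_measurable_Pair measurable_compose[OF measurable_fst idM]
          measurable_compose[OF measurable_snd idM])
  qed
  then have mkM: "(\<lambda>p. k (fst p) (snd p)) \<in> borel_measurable (M \<Otimes>\<^sub>M M)"
    using measurable_compose[OF _ mk] by (simp add: case_prod_beta)
  have mkx: "k x \<in> borel_measurable M"
    using kL2 by (simp add: L2_def M_def)
  have comp: "continuous_on (X \<times> X) (\<lambda>(x, y). LINT z|M. k x z * k z y)"
    unfolding M_def
    by (rule continuous_on_gaussian_composition[OF leb \<Omega>(2) sep a bound])
  \<comment> \<open>Joint continuity restricted to the slice through the fixed
    \<open>x\<close>.\<close>
  have "continuous_on X ((\<lambda>(x, y). LINT z|M. k x z * k z y) \<circ> Pair x)"
    by (rule continuous_on_compose[OF _ continuous_on_subset[OF comp]])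
      (use xy in \<open>auto intro!: continuous_intros\<close>)
  then have cont: "continuous_on X (\<lambda>y. LINT z|M. k x z * k z y)" "continuous_on X (r x)"
    using rsep xy by (simp_all add: comp_def separately_continuous_on_def)
  have eq: "r x y = (LINT z|M. k x z * k z y)" if "y \<in> \<Omega>" for y
  proof (rule continuous_eq_if_test_integrals_eq[where f = "r x" and \<Omega> = \<Omega>, OF \<Omega>(1) _ _ _ that])
    show "continuous_on \<Omega> (r x)" "continuous_on \<Omega> (\<lambda>y. LINT z|M. k x z * k z y)"
      using cont \<Omega>(2) by (auto intro: continuous_on_subset)
    fix u :: "'a \<Rightarrow> complex" and B R'
    assume u: "u \<in> borel_measurable (lebesgue_on \<Omega>)"
      "\<And>x. norm (u x) \<le> B * indicator (cball 0 R') x"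
    note iu = integrable_bounded_support(1)[OF leb u, folded M_def]
    note uL2 = integrable_bounded_support(2)[OF leb u]
    define F where "F = (\<lambda>z y. k x z * k z y * u y)"
    \<comment> \<open>Majorant of \<open>F\<close>: the Gaussian controls \<open>z\<close>, the test
      function controls \<open>y\<close>, and the second kernel factor is at most \<open>C\<close>.
      As a product of integrable functions of separate variables it is integrable over the
      product.\<close>
    define G where "G = (\<lambda>z y. C * exp (- a * (norm (z - x))\<^sup>2) * C * norm (u y))"
    have mu: "u \<in> borel_measurable M" using u by (simp add: M_def)
    have mF: "(\<lambda>p. k x (fst p) * k (fst p) (snd p) * u (snd p)) \<in> borel_measurable (M \<Otimes>\<^sub>M M)"
      by (intro borel_measurable_times mkM measurable_compose[OF measurable_fst mkx]
          measurable_compose[OF measurable_snd mu])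
    have ig: "integrable M (\<lambda>z. exp (- a * (norm (z - x))\<^sup>2))"
      unfolding M_def by (rule integrable_lebesgue_on_gaussian[OF a(1) leb])
    have "integrable (M \<Otimes>\<^sub>M M) (\<lambda>p. G (fst p) (snd p))"
    proof (rule P.Fubini_integrable)
      show "(\<lambda>p. G (fst p) (snd p)) \<in> borel_measurable (M \<Otimes>\<^sub>M M)"
        unfolding G_def
        by (intro borel_measurable_times borel_measurable_const
            measurable_compose[OF measurable_compose[OF measurable_snd mu] borel_measurable_norm]
            measurable_compose[OF measurable_fst borel_measurable_integrable[OF ig]])
      have "(LINT y|M. norm (G z y)) = exp (- a * (norm (z - x))\<^sup>2) * (C * C * (LINT y|M. norm (u y)))" for z
        using a by (simp add: G_def abs_mult mult_ac)
      then show "integrable M (\<lambda>z. LINT y|M. norm (G (fst (z, y)) (snd (z, y))))"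
        using ig by simp
      show "AE z in M. integrable M (\<lambda>y. G (fst (z, y)) (snd (z, y)))"
        using iu by (simp add: G_def)
    qed
    then have "integrable (M \<Otimes>\<^sub>M M) (\<lambda>p. F (fst p) (snd p))"
    proof (rule Bochner_Integration.integrable_bound)
      show "(\<lambda>p. F (fst p) (snd p)) \<in> borel_measurable (M \<Otimes>\<^sub>M M)"
        using mF by (simp add: F_def)
      show "AE p in M \<Otimes>\<^sub>M M. norm (F (fst p) (snd p)) \<le> norm (G (fst p) (snd p))"
      proof (rule AE_I2)
        fix p assume "p \<in> space (M \<Otimes>\<^sub>M M)"
        then have p: "fst p \<in> X" "snd p \<in> X"
          using \<Omega> by (auto simp: space_pair_measure spM)
        have "norm (k x (fst p)) \<le> C * exp (- a * (norm (fst p - x))\<^sup>2)"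
          using bound[OF xy(1) p(1)] by (simp add: norm_minus_commute)
        moreover have "norm (k (fst p) (snd p)) \<le> C"
          by (rule order_trans[OF bound[OF p]]) (use a in \<open>simp add: mult_left_le\<close>)
        ultimately have "norm (F (fst p) (snd p)) \<le> G (fst p) (snd p)"
          unfolding F_def G_def norm_mult by (intro mult_mono) (use a in auto)
        then show "norm (F (fst p) (snd p)) \<le> norm (G (fst p) (snd p))"
          by simp
      qed
    qed
    then have iF: "integrable (M \<Otimes>\<^sub>M M) (case_prod F)"
      by (simp add: case_prod_beta')
    have cv: "is_continuous_version \<Omega> X (T u) (continuous_version \<Omega> X (T u))"
      by (rule is_continuous_version_continuous_version[OF T(2) uL2])
    \<comment> \<open>\<open>RTT\<close> holds only almost everywhere, while \<open>x\<close> may be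
      a boundary point. Evaluation at \<open>x\<close> is justified because both sides have the same
      chosen continuous version.\<close>
    have "(LINT y|M. r x y * u y) = continuous_version \<Omega> X (T (T u)) x"
      using rR[OF uL2 xy(1)] continuous_version_cong[OF RTT[OF uL2]] by simp
    also have "\<dots> = (LINT z|M. k x z * T u z)"
      by (rule kT[OF T(1)[OF uL2] xy(1)])
    \<comment> \<open>\<open>T u\<close> is an arbitrary representative; the kernel formula holds
      pointwise only for its continuous version.\<close>
    also have "\<dots> = (LINT z|M. k x z * continuous_version \<Omega> X (T u) z)"
    proof (rule integral_cong_AE)
      show "(\<lambda>z. k x z * T u z) \<in> borel_measurable M"
        using T(1)[OF uL2] by (intro borel_measurable_times mkx) (simp add: L2_def M_def)
      have "continuous_version \<Omega> X (T u) \<in> borel_measurable M"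
        unfolding M_def using cv \<Omega>(2) leb
        by (intro continuous_imp_measurable_on_sets_lebesgue)
          (auto simp: is_continuous_version_def intro: continuous_on_subset)
      then show "(\<lambda>z. k x z * continuous_version \<Omega> X (T u) z) \<in> borel_measurable M"
        by (intro borel_measurable_times mkx)
      show "AE z in M. k x z * T u z = k x z * continuous_version \<Omega> X (T u) z"
        using cv unfolding is_continuous_version_def L2_eq_def M_def
        by (auto elim: eventually_mono)
    qed
    also have "\<dots> = (LINT z|M. LINT y|M. F z y)"
    proof (rule Bochner_Integration.integral_cong[OF refl])
      fix z assume "z \<in> space M"
      then have "z \<in> X" using spM \<Omega> by auto
      then show "k x z * continuous_version \<Omega> X (T u) z = (LINT y|M. F z y)"
        by (simp add: kT[OF uL2] F_def mult.assoc)
    qed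
    also have "\<dots> = (LINT y|M. LINT z|M. F z y)"
      using P.Fubini_integral[OF iF] by simp
    also have "\<dots> = (LINT y|M. (LINT z|M. k x z * k z y) * u y)"
      by (simp add: F_def)
    finally show "(LINT y|lebesgue_on \<Omega>. r x y * u y)
        = (LINT y|lebesgue_on \<Omega>. (LINT z|M. k x z * k z y) * u y)"
      by (simp add: M_def)
  qed
  \<comment> \<open>Equality on \<Omega>, phrased as an inequality between continuous functions of
    \<open>y\<close>, extends to \<open>X\<close>.\<close>
  have "norm (r x y - (LINT z|M. k x z * k z y)) \<le> 0"
    by (rule continuous_on_le_dense[where X = X and \<Omega> = \<Omega> and g = "\<lambda>_. 0"
          and f = "\<lambda>y. norm (r x y - (LINT z|M. k x z * k z y))"])
      (use cont \<Omega> eq xy in \<open>auto intro!: continuous_intros\<close>)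
  then show ?thesis by (simp add: M_def)
qed

section \<open>Application to the semigroup at half the time\<close>

theorem proposition2p5:
  fixes \<Omega> X :: "(real ^ 'n) set"
    and S :: "real \<Rightarrow> (real ^ 'n \<Rightarrow> complex) \<Rightarrow> (real ^ 'n \<Rightarrow> complex)"
    and K :: "real \<Rightarrow> real ^ 'n \<Rightarrow> real ^ 'n \<Rightarrow> complex"
  assumes "open \<Omega>" and "\<Omega> \<noteq> {}"
    and "\<Omega> \<subseteq> X" and "X \<subseteq> closure \<Omega>"
    and "L2_semigroup \<Omega> S"
    and "\<And>t. t > 0 \<Longrightarrow> L2_range_in_C \<Omega> X (S t)"
    and "\<And>t. t > 0 \<Longrightarrow> L2_range_in_C \<Omega> X (L2_adjoint \<Omega> (S t))"
    and "\<And>t. t > 0 \<Longrightarrow> is_separately_continuous_kernel \<Omega> X (S t) (K t)"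
    and "\<exists>b>0. \<exists>c>0. \<exists>\<omega>>0. \<forall>t>0. \<forall>x\<in>\<Omega>. \<forall>y\<in>\<Omega>.
           norm (K t x y) \<le> c * t powr (- (real CARD('n) / 2))
             * exp (- b * (norm (x - y))\<^sup>2 / t) * exp (\<omega> * t)"
  shows "\<forall>t>0. continuous_on (X \<times> X) (\<lambda>(x, y). K t x y)"
proof (intro allI impI)
  fix t :: real assume "t > 0"
  define s where "s = t / 2"
  have s: "s > 0" "s + s = t" using \<open>t > 0\<close> by (auto simp: s_def)
  obtain b c \<omega> where bc: "b > 0" "c > 0"
    and gauss: "\<And>t x y. t > 0 \<Longrightarrow> x \<in> \<Omega> \<Longrightarrow> y \<in> \<Omega> \<Longrightarrow> norm (K t x y) \<le>
      c * t powr (- (real CARD('n) / 2)) * exp (- b * (norm (x - y))\<^sup>2 / t) * exp (\<omega> * t)"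
    using assms(9) by blast
  \<comment> \<open>At the fixed time \<open>s\<close> the power of the time and the exponential
    growth merge into one constant, and the decay rate becomes \<open>b / s\<close>.\<close>
  define C where "C = c * s powr (- (real CARD('n) / 2)) * exp (\<omega> * s)"
  define a where "a = b / s"
  have aC: "a > 0" "C \<ge> 0" using bc s by (auto simp: a_def C_def)
  have sep: "separately_continuous_on X X (K s)"
    using assms(8)[OF s(1)] by (simp add: is_separately_continuous_kernel_def)
  have "norm (K s x y) \<le> C * exp (- a * (norm (x - y))\<^sup>2)" if "x \<in> \<Omega>" "y \<in> \<Omega>" for x y
    using gauss[OF s(1) that] by (simp add: C_def a_def mult_ac)
  note bound = separately_continuous_gaussian_extends[OF sep assms(3,4) this]
  have S: "S s u \<in> L2 \<Omega>" "L2_eq \<Omega> (S (s + s) u) (S s (S s u))" if "u \<in> L2 \<Omega>" for u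
    using assms(5) s(1) that unfolding L2_semigroup_def L2_bounded_operator_def by blast+
  have "K t x y = (LINT z|lebesgue_on \<Omega>. K s x z * K s z y)" if "x \<in> X" "y \<in> X" for x y
    by (rule kernel_composition_eq[OF assms(1,3,4) S(1) assms(6)[OF s(1)] S(2)[unfolded s(2)] assms(8)[OF s(1)]
          assms(8)[OF \<open>t > 0\<close>] aC bound that])
  moreover have "continuous_on (X \<times> X) (\<lambda>(x, y). LINT z|lebesgue_on \<Omega>. K s x z * K s z y)"
    using assms(1) by (intro continuous_on_gaussian_composition[OF _ assms(3) sep aC bound]) auto
  ultimately show "continuous_on (X \<times> X) (\<lambda>(x, y). K t x y)"
    by (subst continuous_on_cong[OF refl]) auto
qed

end
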